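(* Let $A=\{a_1,\dots,a_n\}$ and $B=\{b_1,\dots,b_m\}$ be finite sets, let $R\subseteq A\times B$ and $w:R\to\mathbb{R}^{+}$, and let $\mathbf{W}=[w_{ij}]$ be the $m\times n$ weight matrix with $w_{ij}=w(a_j,b_i)$ if $(a_j,b_i)\in R$ and $w_{ij}=0$ otherwise. Suppose $\mathbf{W}$ is a positive matrix with pairwise distinct entries. Let $\mathbf{a}\in(\mathbb{R}^{+})^{n}$ with $\|\mathbf{a}\|=1$. Then there exists a function $\varphi:\mathbb{R}^{+}\to\mathbb{R}^{+}$ such that, letting $\mathbf{W}'$ be the $n\times m$ matrix whose $(i,j)$ entry is $\varphi(w(a_i,b_j))$, there is $\mathbf{b}\in(\mathbb{R}^{+})^{m}$ with $(\mathbf{a},\mathbf{b})$ the NEBS associated with $(\mathbf{W},\mathbf{W}')$, i.e. $\mathbf{b}=\lambda\mathbf{W}\mathbf{a}$, $\mathbf{a}=\mu\mathbf{W}'\mathbf{b}$, $\|\mathbf{a}\|=\|\mathbf{b}\|=1$ for some $\lambda>0$, $\mu>0$.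
   Context: $\mathbb{R}^{+}$ denotes the positive reals, so $(\mathbb{R}^{+})^{k}$ is the set of vectors with all entries positive; $\|\cdot\|$ is the Euclidean norm. NEBS stands for normed eigenvector bicentrality sequence: for an $m\times n$ matrix $\mathbf{W}$ and $n\times m$ matrix $\mathbf{W}'$, it is a pair $(\mathbf{a},\mathbf{b})\in(\mathbb{R}^{+})^{n}\times(\mathbb{R}^{+})^{m}$ satisfying the displayed system for some $\lambda,\mu>0$. *)

theory Defs
  imports "HOL-Analysis.Analysis"
begin

definition positive_vec :: "real ^ 'k \<Rightarrow> bool" where
  "positive_vec x \<longleftrightarrow> (\<forall>i. 0 < x $ i)"

definition positive_matrix :: "real ^ 'c ^ 'r \<Rightarrow> bool" where
  "positive_matrix M \<longleftrightarrow> (\<forall>i j. 0 < M $ i $ j)"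

definition distinct_entries :: "real ^ 'c ^ 'r \<Rightarrow> bool" where
  "distinct_entries M \<longleftrightarrow> inj (\<lambda>(i, j). M $ i $ j)"

text \<open>The enumerations \<open>\<alpha>\<close> and \<open>\<beta>\<close> list the elements \<open>a\<^sub>j\<close> of \<open>A\<close> and \<open>b\<^sub>i\<close> of \<open>B\<close>; rows of the
  weight matrix are indexed by \<open>B\<close> and columns by \<open>A\<close>. Values of \<open>w\<close> outside \<open>R\<close> are not used.\<close>

definition weight_matrix ::
  "('a \<times> 'b) set \<Rightarrow> ('a \<times> 'b \<Rightarrow> real) \<Rightarrow> ('n \<Rightarrow> 'a) \<Rightarrow> ('m \<Rightarrow> 'b) \<Rightarrow> real ^ 'n ^ 'm" where
  "weight_matrix R w \<alpha> \<beta> =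
     (\<chi> i j. if (\<alpha> j, \<beta> i) \<in> R then w (\<alpha> j, \<beta> i) else 0)"

definition is_NEBS ::
  "real ^ 'n ^ 'm \<Rightarrow> real ^ 'm ^ 'n \<Rightarrow> real ^ 'n \<Rightarrow> real ^ 'm \<Rightarrow> bool" where
  "is_NEBS W W' a b \<longleftrightarrow>
     positive_vec a \<and> positive_vec b \<and>
     (\<exists>l \<mu>. 0 < l \<and> 0 < \<mu> \<and>
        b = l *\<^sub>R (W *v a) \<and> a = \<mu> *\<^sub>R (W' *v b) \<and> norm a = 1 \<and> norm b = 1)"

end

theory Submission
  imports Defs
begin

text \<open>
  Take \<open>b\<close> to be the normalisation of \<open>W a\<close> and aim for the rank-one matrix \<open>W' = a b\<^sup>T\<close>, for which
  \<open>W' b = \<parallel>b\<parallel>\<^sup>2 a = a\<close>. As the entries of \<open>W\<close> are distinct, each of them determines its position,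
  so any positive matrix, in particular \<open>a b\<^sup>T\<close>, arises from \<open>W\<close> entrywise via some \<open>\<phi>\<close>.
\<close>

lemma positive_vec_mult:
  fixes M :: "real ^ 'n ^ 'm"
  assumes "positive_matrix M" and "positive_vec x"
  shows "positive_vec (M *v x)"
  \<comment> \<open>Each entry is a sum of positive products over an index type, which is never
    empty, so \<open>sum_pos\<close> gives strict positivity.\<close>
  using assms unfolding positive_matrix_def positive_vec_def
  by (auto simp: matrix_vector_mult_def intro!: sum_pos)

lemma positive_vec_scaleR:
  assumes "0 < c" and "positive_vec x"
  shows "positive_vec (c *\<^sub>R x)"
  using assms by (simp add: positive_vec_def)

lemma outer_product_mult_vec:
  fixes a :: "real ^ 'n" and b :: "real ^ 'm"
  shows "(\<chi> i j. a $ i * b $ j) *v b = (norm b)\<^sup>2 *\<^sub>R a"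
  by (simp add: vec_eq_iff matrix_vector_mult_def power2_norm_eq_inner inner_vec_def
      sum_distrib_left sum_distrib_right mult_ac)

lemma positive_matrix_entrywise_image:
  fixes W :: "real ^ 'n ^ 'm" and V :: "real ^ 'm ^ 'n"
  assumes "distinct_entries W" and "positive_matrix V"
  obtains \<phi> :: "real \<Rightarrow> real" where "\<And>x. 0 < \<phi> x" and "\<And>i j. \<phi> (W $ j $ i) = V $ i $ j"
proof
  define f where "f = (\<lambda>(j, i). W $ j $ i)"
  \<comment> \<open>Off the range of \<open>f\<close>, \<open>inv f x\<close> is some arbitrary
    index pair, so \<phi> still returns an entry of \<open>V\<close>; hence it is positive at every
    real.\<close>
  define \<phi> where "\<phi> x = (case inv f x of (j, i) \<Rightarrow> V $ i $ j)" for x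
  show "0 < \<phi> x" for x
    using assms(2) by (simp add: \<phi>_def positive_matrix_def split: prod.split)
  show "\<phi> (W $ j $ i) = V $ i $ j" for i j
  proof -
    have "inj f"
      using assms(1) by (simp add: f_def distinct_entries_def)
    then have "inv f (f (j, i)) = (j, i)"
      by (rule inv_f_f)
    then show ?thesis
      by (simp add: \<phi>_def f_def)
  qed
qed

theorem theorem4p2:
  fixes A :: "'a set" and B :: "'b set"
    and \<alpha> :: "'n::finite \<Rightarrow> 'a" and \<beta> :: "'m::finite \<Rightarrow> 'b"
    and R :: "('a \<times> 'b) set" and w :: "'a \<times> 'b \<Rightarrow> real"
    and a :: "real ^ 'n"
  assumes "bij_betw \<alpha> UNIV A" and "bij_betw \<beta> UNIV B"
    and "R \<subseteq> A \<times> B"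
    and "w \<in> R \<rightarrow> {0<..}"
    and "positive_matrix (weight_matrix R w \<alpha> \<beta>)"
    and "distinct_entries (weight_matrix R w \<alpha> \<beta>)"
    and "positive_vec a" and "norm a = 1"
  shows "\<exists>\<phi>::real \<Rightarrow> real. \<phi> \<in> {0<..} \<rightarrow> {0<..} \<and>
           (\<exists>b :: real ^ 'm.
              is_NEBS (weight_matrix R w \<alpha> \<beta>) (\<chi> i j. \<phi> (w (\<alpha> i, \<beta> j))) a b)"
proof -
  define W where "W = weight_matrix R w \<alpha> \<beta>"
  define b where "b = (1 / norm (W *v a)) *\<^sub>R (W *v a)"
  have W: "positive_matrix W" "distinct_entries W"
    using assms(5,6) by (simp_all add: W_def)
  have Wa: "positive_vec (W *v a)"
    using W(1) assms(7) by (rule positive_vec_mult)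
  then have "W *v a \<noteq> 0"
    by (auto simp: positive_vec_def)
  then have b: "positive_vec b" "norm b = 1" "0 < 1 / norm (W *v a)"
    using Wa by (simp_all add: b_def positive_vec_scaleR)
  have "positive_matrix (\<chi> i j. a $ i * b $ j)"
    using assms(7) b(1) by (simp add: positive_matrix_def positive_vec_def)
  with W(2) obtain \<phi> :: "real \<Rightarrow> real" where \<phi>: "\<And>x. 0 < \<phi> x"
    "\<And>i j. \<phi> (W $ j $ i) = (\<chi> i j. a $ i * b $ j) $ i $ j"
    by (rule positive_matrix_entrywise_image) blast
  \<comment> \<open>A zero entry would contradict positivity of \<open>W\<close>, so the default
    branch never occurs and every pair lies in \<open>R\<close>. The indices swap because rows of
    \<open>W\<close> belong to \<open>B\<close>.\<close>
  have "w (\<alpha> i, \<beta> j) = W $ j $ i" for i j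
    using W(1)[unfolded positive_matrix_def, rule_format, of j i]
    by (simp add: W_def weight_matrix_def split: if_splits)
  then have "(\<chi> i j. \<phi> (w (\<alpha> i, \<beta> j))) = (\<chi> i j. a $ i * b $ j)"
    using \<phi>(2) by simp
  moreover have "a = 1 *\<^sub>R ((\<chi> i j. a $ i * b $ j) *v b)"
    by (simp add: outer_product_mult_vec b(2))
  \<comment> \<open>The scalars are \<open>l = 1 / norm (W *v a)\<close>, from the normalisation
    defining \<open>b\<close>, and \<mu> = 1, since \<open>b\<close> has norm one.\<close>
  ultimately have "is_NEBS W (\<chi> i j. \<phi> (w (\<alpha> i, \<beta> j))) a b"
    unfolding is_NEBS_def using assms(7,8) b b_def zero_less_one by metis
  with \<phi>(1) show ?thesis
    unfolding W_def by auto
qed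

end
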